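(* Let $X$ be a paracompact connected space, let $(Z_s)_{s\in S}$ be a family of equiconnected metrizable spaces, let $Z=\prod_{s\in S}Z_s$ be endowed with the box topology, and let $g:X\to Z$ be a Baire-one map. Then there exists a separately continuous map $f:X^2\to Z$ with the diagonal $g$, i.e. such that $f(x,x)=g(x)$ for all $x\in X$.
   Context: Paracompact spaces are understood to be Hausdorff. The box topology on $\prod_{s\in S}Z_s$ is the topology generated by all boxes $\prod_{s\in S}G_s$, where $G_s\subseteq Z_s$ is open for every $s\in S$ (the index set $S$ is arbitrary). A topological space $Y$ is equiconnected if there exists a continuous map $\lambda:Y\times Y\times[0,1]\to Y$ such that $\lambda(x,y,0)=\lambda(y,x,1)=x$ for all $x,y\in Y$ and $\lambda(x,x,t)=x$ for all $x\in Y$, $t\in[0,1]$. A map $g:X\to Z$ is Baire-one (of the first Baire class) if there is a sequence of continuous maps $g_k:X\to Z$ with $\lim_{k\to\infty}g_k(x)=g(x)$ in $Z$ for every $x\in X$. A map $f:X\times X\to Z$ is separately continuous if for every $x\in X$ the maps $y\mapsto f(x,y)$ and $y\mapsto f(y,x)$ are continuous on $X$. *)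

theory Defs
  imports "HOL-Analysis.Analysis"
begin

definition paracompact_space :: "'a topology \<Rightarrow> bool" where
  "paracompact_space X \<longleftrightarrow>
     Hausdorff_space X \<and>
     (\<forall>\<U>. (\<forall>U\<in>\<U>. openin X U) \<and> \<Union>\<U> = topspace X \<longrightarrow>
        (\<exists>\<V>. (\<forall>V\<in>\<V>. openin X V) \<and> \<Union>\<V> = topspace X \<and>
             (\<forall>V\<in>\<V>. \<exists>U\<in>\<U>. V \<subseteq> U) \<and> locally_finite_in X \<V>))"

definition box_topology :: "('s \<Rightarrow> 'b topology) \<Rightarrow> 's set \<Rightarrow> ('s \<Rightarrow> 'b) topology" where
  "box_topology Z S =
     topology_generated_by {Pi\<^sub>E S G | G. \<forall>s\<in>S. openin (Z s) (G s)}"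

lemma topspace_box_topology:
  "topspace (box_topology Z S) = (\<Pi>\<^sub>E s\<in>S. topspace (Z s))"
proof
  show "topspace (box_topology Z S) \<subseteq> (\<Pi>\<^sub>E s\<in>S. topspace (Z s))"
    unfolding box_topology_def topology_generated_by_topspace
  proof (rule Union_least)
    fix B assume "B \<in> {Pi\<^sub>E S G | G. \<forall>s\<in>S. openin (Z s) (G s)}"
    then obtain G where "B = Pi\<^sub>E S G" and "\<forall>s\<in>S. openin (Z s) (G s)"
      by auto
    then show "B \<subseteq> (\<Pi>\<^sub>E s\<in>S. topspace (Z s))"
      by (simp add: PiE_mono openin_subset)
  qed
  have "(\<Pi>\<^sub>E s\<in>S. topspace (Z s)) \<in> {Pi\<^sub>E S G | G. \<forall>s\<in>S. openin (Z s) (G s)}"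
    by (intro CollectI exI[of _ "\<lambda>s. topspace (Z s)"]) simp
  then show "(\<Pi>\<^sub>E s\<in>S. topspace (Z s)) \<subseteq> topspace (box_topology Z S)"
    unfolding box_topology_def topology_generated_by_topspace by (rule Union_upper)
qed

definition equiconnected_space :: "'a topology \<Rightarrow> bool" where
  "equiconnected_space Y \<longleftrightarrow>
     (\<exists>h. continuous_map (prod_topology Y (prod_topology Y (top_of_set {0..1::real}))) Y h \<and>
          (\<forall>x\<in>topspace Y. \<forall>y\<in>topspace Y. h (x, y, 0) = x \<and> h (y, x, 1) = x) \<and>
          (\<forall>x\<in>topspace Y. \<forall>t\<in>{0..1}. h (x, x, t) = x))"

definition Baire_one_map :: "'a topology \<Rightarrow> 'b topology \<Rightarrow> ('a \<Rightarrow> 'b) \<Rightarrow> bool" where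
  "Baire_one_map X Z g \<longleftrightarrow>
     g \<in> topspace X \<rightarrow> topspace Z \<and>
     (\<exists>gk :: nat \<Rightarrow> 'a \<Rightarrow> 'b. (\<forall>k. continuous_map X Z (gk k)) \<and>
        (\<forall>x\<in>topspace X. limitin Z (\<lambda>k. gk k x) (g x) sequentially))"

definition separately_continuous_map ::
    "'a topology \<Rightarrow> 'b topology \<Rightarrow> ('a \<times> 'a \<Rightarrow> 'b) \<Rightarrow> bool" where
  "separately_continuous_map X Z f \<longleftrightarrow>
     (\<forall>x\<in>topspace X. continuous_map X Z (\<lambda>y. f (x, y)) \<and> continuous_map X Z (\<lambda>y. f (y, x)))"

end

theory Submission
  imports Defs
begin

text \<open>
  By connectedness any two values of a continuous map into the box product differ in finitely
  many coordinates, and a sequence converging in the box topology is eventually constant outside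
  a finite set of coordinates. Hence, if \<open>g\<close> is the limit of \<open>g\<^sub>k\<close> and \<open>x\<^sub>0\<close> is fixed, then after dropping
  finitely many \<open>k\<close> the set \<open>E x\<close> of coordinates in which some \<open>g\<^sub>k x\<close> differs from \<open>c = g x\<^sub>0\<close> is
  finite for every \<open>x\<close>. It therefore suffices to find, for each single coordinate \<open>s\<close>, a separately
  continuous extension of \<open>g\<close> from the diagonal that equals \<open>c s\<close> at \<open>(x, y)\<close> unless \<open>s\<close> lies in both
  \<open>E x\<close> and \<open>E y\<close>: the sections of the product map then move only finitely many coordinates.

  For one coordinate, a pseudometric \<open>\<rho>\<close> on \<open>X\<close> measures how far the sequences \<open>(g\<^sub>k x)\<close> and \<open>(g\<^sub>k y)\<close>
  are apart, and \<open>u\<close> is the distance from the constant sequence \<open>c\<close>. The value at \<open>(x, y)\<close> is read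
  off at time \<open>min (u x) (u y) / \<rho> x y\<close> on the path joining \<open>c, g\<^sub>0 x, g\<^sub>1 x, \<dots>\<close> successively. Near the
  diagonal the time is large; away from it, if \<open>u\<close> vanishes at one of the points, the time is 0.
\<close>

section \<open>The box topology: coordinates, maps into boxes, convergent sequences\<close>

lemma openin_box:
  "(\<And>s. s \<in> S \<Longrightarrow> openin (Z s) (G s)) \<Longrightarrow> openin (box_topology Z S) (Pi\<^sub>E S G)"
  unfolding box_topology_def by (rule topology_generated_by_Basis) auto

lemma continuous_map_box_coordinate:
  assumes f: "continuous_map X (box_topology Z S) f" and s: "s \<in> S"
  shows "continuous_map X (Z s) (\<lambda>x. f x s)"
proof -
  have "continuous_map (box_topology Z S) (Z s) (\<lambda>z. z s)"
    unfolding continuous_map_def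
  proof (intro conjI allI impI)
    show "(\<lambda>z. z s) \<in> topspace (box_topology Z S) \<rightarrow> topspace (Z s)"
      using s by (auto simp: topspace_box_topology)
    fix U assume U: "openin (Z s) U"
    let ?G = "\<lambda>r. if r = s then U else topspace (Z r)"
    have "{z \<in> topspace (box_topology Z S). z s \<in> U} = Pi\<^sub>E S ?G"
    proof (intro set_eqI iffI)
      fix z assume z: "z \<in> Pi\<^sub>E S ?G"
      then have "z r \<in> topspace (Z r)" if "r \<in> S" for r
        using PiE_mem[OF z that] openin_subset[OF U] by (auto split: if_splits)
      moreover have "z s \<in> U" using PiE_mem[OF z s] by simp
      ultimately show "z \<in> {z \<in> topspace (box_topology Z S). z s \<in> U}"
        using z by (simp add: topspace_box_topology PiE_iff)
    qed (auto simp: topspace_box_topology PiE_iff)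
    then show "openin (box_topology Z S) {z \<in> topspace (box_topology Z S). z s \<in> U}"
      using U by (auto intro: openin_box)
  qed
  then show ?thesis
    using continuous_map_compose[OF f] by (simp add: o_def)
qed

lemma limitin_box_coordinate:
  assumes "limitin (box_topology Z S) z l F" and s: "s \<in> S"
  shows "limitin (Z s) (\<lambda>k. z k s) (l s) F"
proof -
  have "continuous_map (box_topology Z S) (Z s) (\<lambda>z. z s)"
    by (rule continuous_map_box_coordinate[OF continuous_map_id[unfolded id_def] s])
  from continuous_map_limit[OF this assms(1)] show ?thesis
    by (simp add: o_def)
qed

text \<open>Outside \<open>E\<close> the coordinates do not depend on \<open>x\<close>: they either
  rule out a given box for every \<open>x\<close>, or leave only the finitely many open conditions
  coming from \<open>E\<close>.\<close>

lemma continuous_map_into_box_finite: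
  assumes coord: "\<And>s. s \<in> S \<Longrightarrow> continuous_map X (Z s) (\<lambda>x. f x s)"
    and ext: "\<And>x. x \<in> topspace X \<Longrightarrow> f x \<in> extensional S"
    and fin: "finite E"
    and const: "\<And>x s. \<lbrakk>x \<in> topspace X; s \<in> S - E\<rbrakk> \<Longrightarrow> f x s = c s"
  shows "continuous_map X (box_topology Z S) f"
  unfolding box_topology_def
proof (rule continuous_on_generated_topo)
  fix U assume "U \<in> {Pi\<^sub>E S G | G. \<forall>s\<in>S. openin (Z s) (G s)}"
  then obtain G where U: "U = Pi\<^sub>E S G" and G: "\<And>s. s \<in> S \<Longrightarrow> openin (Z s) (G s)"
    by blast
  show "openin X (f -` U \<inter> topspace X)"
  proof (cases "\<forall>s\<in>S - E. c s \<in> G s")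
    case True
    have "f -` U \<inter> topspace X = topspace X \<inter> (\<Inter>s\<in>E \<inter> S. {x \<in> topspace X. f x s \<in> G s})"
    proof (intro set_eqI iffI)
      fix x assume x: "x \<in> topspace X \<inter> (\<Inter>s\<in>E \<inter> S. {x \<in> topspace X. f x s \<in> G s})"
      have "f x s \<in> G s" if "s \<in> S" for s
        using x that True const[of x s] by (cases "s \<in> E") auto
      then show "x \<in> f -` U \<inter> topspace X"
        using x ext by (auto simp: U PiE_iff)
    qed (auto simp: U PiE_iff)
    moreover have "openin X \<dots>"
    proof (rule openin_Int_Inter)
      show "finite ((\<lambda>s. {x \<in> topspace X. f x s \<in> G s}) ` (E \<inter> S))"
        using fin by simp
      show "openin X T" if "T \<in> (\<lambda>s. {x \<in> topspace X. f x s \<in> G s}) ` (E \<inter> S)" for T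
        using that by clarify (rule openin_continuous_map_preimage[OF coord G])
    qed simp
    ultimately show ?thesis by simp
  next
    case False
    then have "f -` U \<inter> topspace X = {}"
      using const by (force simp: U PiE_iff)
    then show ?thesis by simp
  qed
next
  have "f x \<in> Pi\<^sub>E S (\<lambda>s. topspace (Z s))" if "x \<in> topspace X" for x
    using that ext coord by (auto simp: PiE_iff continuous_map_def)
  then show "f ` topspace X \<subseteq> \<Union> {Pi\<^sub>E S G | G. \<forall>s\<in>S. openin (Z s) (G s)}"
    using topspace_box_topology[of Z S, unfolded box_topology_def topology_generated_by_topspace] by simp blast
qed

text \<open>Excluding one term \<open>z (n s) s \<noteq> l s\<close> in each coordinate \<open>s\<close> leaves a box around \<open>l\<close>.\<close>

lemma limitin_box_bounded_index:
  fixes z :: "nat \<Rightarrow> 's \<Rightarrow> 'b" and n :: "'s \<Rightarrow> nat"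
  assumes lim: "limitin (box_topology Z S) z l sequentially"
    and t1: "\<And>s. s \<in> S \<Longrightarrow> t1_space (Z s)"
  obtains K where "\<And>s. \<lbrakk>s \<in> S; z (n s) s \<noteq> l s\<rbrakk> \<Longrightarrow> n s < K"
proof -
  define G where "G = (\<lambda>s. if z (n s) s = l s then topspace (Z s) else topspace (Z s) - {z (n s) s})"
  have l: "l \<in> (\<Pi>\<^sub>E s\<in>S. topspace (Z s))"
    using lim by (simp add: limitin_def topspace_box_topology)
  have "openin (Z s) (G s)" if "s \<in> S" for s
    using t1[OF that] by (auto simp: G_def t1_space_openin_delete_alt)
  then have "openin (box_topology Z S) (Pi\<^sub>E S G)"
    by (rule openin_box)
  moreover have "l \<in> Pi\<^sub>E S G"
    using l by (auto simp: G_def PiE_iff)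
  ultimately have "eventually (\<lambda>k. z k \<in> Pi\<^sub>E S G) sequentially"
    using lim by (simp add: limitin_def)
  then obtain K where K: "\<And>k. k \<ge> K \<Longrightarrow> z k \<in> Pi\<^sub>E S G"
    by (auto simp: eventually_sequentially)
  have "n s < K" if "s \<in> S" "z (n s) s \<noteq> l s" for s
  proof (rule ccontr)
    assume "\<not> n s < K"
    then have "z (n s) s \<in> G s"
      using K[of "n s"] that(1) by (auto simp: PiE_iff)
    then show False
      using that(2) by (simp add: G_def)
  qed
  then show ?thesis by (rule that)
qed

text \<open>The bound on bad indices is applied twice: to arbitrarily late bad indices in infinitely
  many coordinates, which cannot exist, and to the last bad index in each of the remaining
  coordinates, which yields \<open>K\<close>.\<close>

lemma limitin_box_eventually_equal:
  fixes z :: "nat \<Rightarrow> 's \<Rightarrow> 'b"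
  assumes lim: "limitin (box_topology Z S) z l sequentially"
    and t1: "\<And>s. s \<in> S \<Longrightarrow> t1_space (Z s)"
  obtains K where "finite {s \<in> S. \<exists>k\<ge>K. z k s \<noteq> l s}"
proof -
  define B where "B = (\<lambda>s. {k. z k s \<noteq> l s})"
  define I where "I = {s \<in> S. infinite (B s)}"
  have "finite I"
  proof (rule ccontr)
    assume "infinite I"
    then obtain e :: "nat \<Rightarrow> 's" where e: "inj e" "range e \<subseteq> I"
      by (metis infinite_countable_subset)
    have "\<exists>k\<ge>i. k \<in> B (e i)" for i
      using e(2) by (auto simp: I_def infinite_nat_iff_unbounded_le)
    then obtain b where b: "\<And>i. b i \<ge> i" "\<And>i. b i \<in> B (e i)"
      by metis
    \<comment> \<open>\<open>inv e\<close> turns the chosen \<open>b\<close> into one index per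
      coordinate; its values off the range of \<open>e\<close> do not matter. At the coordinate
      \<open>e K\<close> the bound reads \<open>b K < K\<close>, against
      \<open>b K \<ge> K\<close>.\<close>
    obtain K where "\<And>s. \<lbrakk>s \<in> S; z (b (inv e s)) s \<noteq> l s\<rbrakk> \<Longrightarrow> b (inv e s) < K"
      using limitin_box_bounded_index[OF lim t1, of "\<lambda>s. b (inv e s)"] by auto
    from this[of "e K"] show False
      using e b[of K] by (auto simp: I_def B_def)
  qed
  \<comment> \<open>\<open>Max (B s)\<close> is meaningful only when \<open>B s\<close> is finite
    and nonempty, and the bound is used below only for such \<open>s\<close>.\<close>
  moreover obtain K where K: "\<And>s. \<lbrakk>s \<in> S; z (Max (B s)) s \<noteq> l s\<rbrakk> \<Longrightarrow> Max (B s) < K"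
    using limitin_box_bounded_index[OF lim t1, of "\<lambda>s. Max (B s)"] by auto
  have "s \<in> I" if s: "s \<in> S" "k \<ge> K" "z k s \<noteq> l s" for s k
  proof (rule ccontr)
    assume "s \<notin> I"
    then have "finite (B s)" using s by (simp add: I_def)
    moreover have "k \<in> B s" using s by (simp add: B_def)
    ultimately have "Max (B s) \<in> B s" "k \<le> Max (B s)"
      by (auto intro: Max_in)
    then show False
      using K[OF s(1)] s by (auto simp: B_def)
  qed
  then have "{s \<in> S. \<exists>k\<ge>K. z k s \<noteq> l s} \<subseteq> I" by blast
  ultimately show ?thesis
    using that finite_subset by blast
qed

section \<open>Connectedness against the box topology\<close>

text \<open>If infinitely many coordinates differed, the points whose images stay within a bounded
  multiple of a suitable sequence of radii from \<open>h x\<close> would form a clopen set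
  containing \<open>x\<close> but not \<open>y\<close>.\<close>

lemma connected_continuous_box_finite_difference:
  fixes h :: "'a \<Rightarrow> 's \<Rightarrow> 'b"
  assumes conn: "connected_space X"
    and h: "continuous_map X (box_topology Z S) h"
    and metr: "\<And>s. s \<in> S \<Longrightarrow> metrizable_space (Z s)"
    and x: "x \<in> topspace X" and y: "y \<in> topspace X"
  shows "finite {s \<in> S. h x s \<noteq> h y s}"
proof (rule ccontr)
  assume "infinite {s \<in> S. h x s \<noteq> h y s}"
  then obtain e :: "nat \<Rightarrow> 's" where e: "inj e" "range e \<subseteq> {s \<in> S. h x s \<noteq> h y s}"
    by (metis infinite_countable_subset)
  then have eS: "e n \<in> S" and ne: "h x (e n) \<noteq> h y (e n)" for n by auto
  have "\<exists>d. Metric_space (topspace (Z (e n))) d \<and> Z (e n) = Metric_space.mtopology (topspace (Z (e n))) d" for n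
    using metr[OF eS[of n]] unfolding metrizable_space_def by (metis Metric_space.topspace_mtopology)
  then obtain d where d: "\<And>n. Metric_space (topspace (Z (e n))) (d n)"
      and Zd: "\<And>n. Z (e n) = Metric_space.mtopology (topspace (Z (e n))) (d n)"
    by metis
  have hM: "h w (e n) \<in> topspace (Z (e n))" if "w \<in> topspace X" for w n
    using continuous_map_box_coordinate[OF h eS] that by (auto simp: continuous_map_def)
  \<comment> \<open>The distance from \<open>h x\<close> to \<open>h y\<close> in coordinate
    \<open>e n\<close> is \<open>(n + 1) * c n\<close>, hence not bounded by any fixed multiple of
    \<open>c n\<close>; this keeps \<open>y\<close> out of \<open>A\<close>.\<close>
  define c where "c = (\<lambda>n. d n (h x (e n)) (h y (e n)) / (real n + 1))"
  have c: "c n > 0" for n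
    using Metric_space.mdist_pos_eq[OF d] hM x y ne by (simp add: c_def)
  \<comment> \<open>\<open>A\<close> is clopen: moving each coordinate \<open>e n\<close> by at most \<open>c n\<close> changes \<open>C\<close> by at most 1.\<close>
  define A where "A = {w \<in> topspace X. \<exists>C. \<forall>n. d n (h x (e n)) (h w (e n)) \<le> C * c n}"
  have nbhd: "\<exists>V. openin X V \<and> w \<in> V \<and> (\<forall>v\<in>V. v \<in> A \<longleftrightarrow> w \<in> A)" if w: "w \<in> topspace X" for w
  proof -
    \<comment> \<open>Infinitely many coordinates are restricted at once, which the box topology
      permits for open sets.\<close>
    define G where "G = (\<lambda>s. if s \<in> range e
        then Metric_space.mball (topspace (Z s)) (d (inv e s)) (h w s) (c (inv e s)) else topspace (Z s))"
    define V where "V = {v \<in> topspace X. h v \<in> Pi\<^sub>E S G}"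
    have "openin (Z s) (G s)" if "s \<in> S" for s
    proof (cases "s \<in> range e")
      case True
      then obtain n where n: "s = e n" by auto
      show ?thesis
        using Metric_space.openin_mball[OF d[of n], of "h w s" "c n"] e(1) Zd[of n]
        by (simp add: G_def n)
    qed (simp add: G_def)
    then have "openin X V"
      unfolding V_def by (intro openin_continuous_map_preimage[OF h] openin_box)
    moreover have "h w \<in> Pi\<^sub>E S (\<lambda>s. topspace (Z s))"
      using h w by (auto simp: continuous_map_def topspace_box_topology)
    then have "w \<in> V"
      using w c e(1) by (auto simp: V_def G_def PiE_iff Metric_space.centre_in_mball_iff[OF d])
    moreover have "v \<in> A \<longleftrightarrow> w \<in> A" if v: "v \<in> V" for v
    proof -
      have vX: "v \<in> topspace X" using v by (simp add: V_def)
      have dvw: "d n (h w (e n)) (h v (e n)) \<le> c n" for n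
      proof -
        have "h v (e n) \<in> G (e n)" using v eS by (auto simp: V_def)
        then show ?thesis
          using e(1) by (auto simp: G_def Metric_space.in_mball[OF d])
      qed
      \<comment> \<open>Used in both directions between \<open>v\<close> and \<open>w\<close>, so
        that the complement of \<open>A\<close> is open as well.\<close>
      have step: "b \<in> A" if "a \<in> A" "b \<in> topspace X" "\<And>n. d n (h a (e n)) (h b (e n)) \<le> c n" for a b
      proof -
        obtain C where C: "\<And>n. d n (h x (e n)) (h a (e n)) \<le> C * c n"
          using \<open>a \<in> A\<close> by (auto simp: A_def)
        have a: "a \<in> topspace X" using \<open>a \<in> A\<close> by (simp add: A_def)
        have "d n (h x (e n)) (h b (e n)) \<le> (C + 1) * c n" for n
        proof -
          have "d n (h x (e n)) (h b (e n)) \<le> d n (h x (e n)) (h a (e n)) + d n (h a (e n)) (h b (e n))"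
            by (intro Metric_space.triangle[OF d] hM x a that)
          also have "\<dots> \<le> C * c n + c n" by (intro add_mono C that)
          finally show ?thesis by (simp add: algebra_simps)
        qed
        then show ?thesis using that by (auto simp: A_def)
      qed
      have dwv: "d n (h v (e n)) (h w (e n)) \<le> c n" for n
        using dvw[of n] Metric_space.commute[OF d] by simp
      show ?thesis
        using step[OF _ w dwv] step[OF _ vX dvw] by blast
    qed
    ultimately show ?thesis by blast
  qed
  have "openin X A"
    unfolding openin_subopen[of X A]
  proof
    fix w assume w: "w \<in> A"
    then have "w \<in> topspace X" by (simp add: A_def)
    from nbhd[OF this] w show "\<exists>T. openin X T \<and> w \<in> T \<and> T \<subseteq> A" by blast
  qed
  moreover have "openin X (topspace X - A)"
    unfolding openin_subopen[of X "topspace X - A"]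
  proof
    fix w assume w: "w \<in> topspace X - A"
    then obtain V where "openin X V" "w \<in> V" "\<forall>v\<in>V. v \<in> A \<longleftrightarrow> w \<in> A"
      using nbhd by blast
    with w show "\<exists>T. openin X T \<and> w \<in> T \<and> T \<subseteq> topspace X - A"
      using openin_subset by blast
  qed
  then have "closedin X A"
    by (simp add: closedin_def A_def)
  ultimately have "A = {} \<or> A = topspace X"
    using conn by (auto simp: connected_space_clopen_in)
  moreover have "x \<in> A"
    using x hM[OF x] c by (auto simp: A_def Metric_space.mdist_zero[OF d] less_imp_le intro!: exI[of _ 0])
  ultimately have "y \<in> A" using y by blast
  then obtain C where C: "\<And>n. d n (h x (e n)) (h y (e n)) \<le> C * c n"
    by (auto simp: A_def)
  obtain n where n: "C < real n" using reals_Archimedean2 by blast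
  have "(real n + 1) * c n \<le> C * c n"
    using C[of n] by (simp add: c_def)
  then show False
    using c[of n] n by simp
qed

section \<open>Paths through a sequence of points in an equiconnected space\<close>

text \<open>A concatenation of paths: from time \<open>k\<close> to time \<open>k + 1\<close> it
  follows \<open>h\<close> from \<open>a k\<close> to \<open>a (Suc k)\<close>.\<close>

definition telescope :: "('b \<times> 'b \<times> real \<Rightarrow> 'b) \<Rightarrow> (nat \<Rightarrow> 'b) \<Rightarrow> real \<Rightarrow> 'b" where
  "telescope h a t = h (a (nat \<lfloor>t\<rfloor>), a (Suc (nat \<lfloor>t\<rfloor>)), frac t)"

text \<open>Both the points and the time may vary with \<open>w\<close>. The closed sets on which
  the time lies in \<open>{real k..real k + 1}\<close> are locally finite, and the formulas on
  neighbouring pieces agree at the common integer time.\<close>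

lemma continuous_map_telescope:
  assumes h: "continuous_map (prod_topology Y (prod_topology Y (top_of_set {0..1::real}))) Y h"
    and h01: "\<And>x y. \<lbrakk>x \<in> topspace Y; y \<in> topspace Y\<rbrakk> \<Longrightarrow> h (x, y, 0) = x \<and> h (y, x, 1) = x"
    and a: "\<And>k. continuous_map W Y (a k)"
    and t: "continuous_map W euclideanreal t"
    and t0: "\<And>w. w \<in> topspace W \<Longrightarrow> t w \<ge> 0"
  shows "continuous_map W Y (\<lambda>w. telescope h (\<lambda>k. a k w) (t w))"
proof (rule pasting_lemma_locally_finite
    [where I = "UNIV :: nat set" and T = "\<lambda>k. {w \<in> topspace W. t w \<in> {real k..real k + 1}}"
       and f = "\<lambda>k w. h (a k w, a (Suc k) w, t w - real k)"])
  fix w assume w: "w \<in> topspace W"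
  define V where "V = {v \<in> topspace W. t v \<in> {..<t w + 1}}"
  have "openin W V"
    unfolding V_def by (rule openin_continuous_map_preimage[OF t]) simp
  moreover have "w \<in> V"
    using w by (simp add: V_def)
  moreover have "{k. {w \<in> topspace W. t w \<in> {real k..real k + 1}} \<inter> V \<noteq> {}} \<subseteq> {..nat \<lceil>t w + 1\<rceil>}"
    by (auto simp: V_def) linarith
  then have "finite {k \<in> UNIV. {w \<in> topspace W. t w \<in> {real k..real k + 1}} \<inter> V \<noteq> {}}"
    using finite_subset by fastforce
  ultimately show "\<exists>V. openin W V \<and> w \<in> V \<and>
      finite {k \<in> UNIV. {w \<in> topspace W. t w \<in> {real k..real k + 1}} \<inter> V \<noteq> {}}"
    by blast
next
  fix k :: nat
  show "closedin W {w \<in> topspace W. t w \<in> {real k..real k + 1}}"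
    by (rule closedin_continuous_map_preimage[OF t]) simp
  have "continuous_map (subtopology W {w \<in> topspace W. t w \<in> {real k..real k + 1}})
      (prod_topology Y (prod_topology Y (top_of_set {0..1::real})))
      (\<lambda>w. (a k w, a (Suc k) w, t w - real k))"
    unfolding continuous_map_pairwise o_def continuous_map_in_subtopology fst_conv snd_conv
    by (intro conjI continuous_map_from_subtopology a t continuous_map_diff continuous_map_const[THEN iffD2]) auto
  from continuous_map_compose[OF this h]
  show "continuous_map (subtopology W {w \<in> topspace W. t w \<in> {real k..real k + 1}}) Y
      (\<lambda>w. h (a k w, a (Suc k) w, t w - real k))"
    by (simp add: o_def)
next
  have aY: "a k w \<in> topspace Y" if "w \<in> topspace W" for k w
    using a[of k] that by (auto simp: continuous_map_def)
  have agree: "h (a i w, a (Suc i) w, t w - real i) = h (a j w, a (Suc j) w, t w - real j)"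
    if "w \<in> topspace W" "t w \<in> {real i..real i + 1}" "t w \<in> {real j..real j + 1}" "i < j" for i j w
  proof -
    \<comment> \<open>Distinct pieces meet only if they are consecutive; there both formulas give
      \<open>a (Suc i) w\<close>.\<close>
    have "j = Suc i" "t w = real i + 1" using that by auto
    then show ?thesis using h01 aY[OF that(1)] by simp
  qed
  fix i j :: nat and w
  assume w: "w \<in> topspace W \<inter> {w \<in> topspace W. t w \<in> {real i..real i + 1}} \<inter> {w \<in> topspace W. t w \<in> {real j..real j + 1}}"
  show "h (a i w, a (Suc i) w, t w - real i) = h (a j w, a (Suc j) w, t w - real j)"
  proof (cases i j rule: linorder_cases)
    case less
    with w show ?thesis by (intro agree) auto
  next
    case greater
    with w show ?thesis by (intro agree[symmetric]) auto
  qed simp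
next
  fix w assume w: "w \<in> topspace W"
  have "real (nat \<lfloor>t w\<rfloor>) = of_int \<lfloor>t w\<rfloor>"
    using t0[OF w] by simp
  then show "\<exists>k. k \<in> UNIV \<and> w \<in> {w \<in> topspace W. t w \<in> {real k..real k + 1}} \<and>
      telescope h (\<lambda>k. a k w) (t w) = h (a k w, a (Suc k) w, t w - real k)"
    using w by (intro exI[of _ "nat \<lfloor>t w\<rfloor>"]) (auto simp: telescope_def frac_def)
qed

text \<open>The constant path at \<open>z\<close> stays in \<open>U\<close>. Since the time interval
  is compact, the Wallace theorem, applied once for each endpoint, extends this to all endpoints
  near \<open>z\<close>.\<close>

lemma equiconnecting_tube:
  assumes h: "continuous_map (prod_topology Y (prod_topology Y (top_of_set {0..1::real}))) Y h"
    and hid: "\<And>t. t \<in> {0..1} \<Longrightarrow> h (z, z, t) = z"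
    and U: "openin Y U" "z \<in> U"
  obtains N where "openin Y N" "z \<in> N" "\<And>x y t. \<lbrakk>x \<in> N; y \<in> N; t \<in> {0..1}\<rbrakk> \<Longrightarrow> h (x, y, t) \<in> U"
proof -
  let ?I = "top_of_set {0..1::real}"
  have z: "z \<in> topspace Y" using U openin_subset by blast
  define W where "W = {p \<in> topspace (prod_topology Y (prod_topology Y ?I)). h p \<in> U}"
  have W: "openin (prod_topology Y (prod_topology Y ?I)) W"
    unfolding W_def by (rule openin_continuous_map_preimage[OF h U(1)])
  have I: "compactin ?I {0..1}"
    by (simp add: compactin_subtopology)
  have c: "compactin (prod_topology Y ?I) ({z} \<times> {0..1})"
    using z I by (simp add: compactin_Times)
  have "{z} \<times> ({z} \<times> {0..1}) \<subseteq> W"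
    using z hid U by (auto simp: W_def)
  with z obtain N1 V where N1: "openin Y N1" "z \<in> N1"
      and V: "openin (prod_topology Y ?I) V" "{z} \<times> {0..1} \<subseteq> V" "N1 \<times> V \<subseteq> W"
    using Wallace_theorem_prod_topology[OF _ c W, of "{z}"] by (metis compactin_sing insert_subset)
  with z obtain N2 T where N2: "openin Y N2" "z \<in> N2"
      and T: "{0..1} \<subseteq> T" "N2 \<times> T \<subseteq> V"
    using Wallace_theorem_prod_topology[OF _ I V(1), of "{z}"] by (metis compactin_sing insert_subset)
  show ?thesis
  proof (rule that)
    show "openin Y (N1 \<inter> N2)" "z \<in> N1 \<inter> N2"
      using N1 N2 by auto
    fix x y and t :: real assume "x \<in> N1 \<inter> N2" "y \<in> N1 \<inter> N2" "t \<in> {0..1}"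
    then have "(x, y, t) \<in> W" using T V by blast
    then show "h (x, y, t) \<in> U" by (simp add: W_def)
  qed
qed

section \<open>A bounded metric on sequences of points\<close>

context Metric_space
begin

text \<open>The weights tend to 0, for continuity, but so slowly that \<open>seq_dist a b \<le> 1 / n\<close>
  still controls the terms with index \<open>n\<close> and \<open>Suc n\<close>.\<close>

definition seq_dist :: "(nat \<Rightarrow> 'a) \<Rightarrow> (nat \<Rightarrow> 'a) \<Rightarrow> real" where
  "seq_dist a b = (SUP k. min (2 / (real k + 2)) (d (a k) (b k)))"

lemma seq_dist_upper: "min (2 / (real k + 2)) (d (a k) (b k)) \<le> seq_dist a b"
  unfolding seq_dist_def
  by (rule cSUP_upper) (auto intro!: bdd_aboveI[of _ 1] min.coboundedI1)

lemma seq_dist_least: "(\<And>k. min (2 / (real k + 2)) (d (a k) (b k)) \<le> C) \<Longrightarrow> seq_dist a b \<le> C"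
  unfolding seq_dist_def by (rule cSUP_least) auto

lemma seq_dist_nonneg: "seq_dist a b \<ge> 0"
  by (rule order_trans[OF _ seq_dist_upper[of 0 a b]]) simp

lemma seq_dist_le_1: "seq_dist a b \<le> 1"
  by (rule seq_dist_least) (auto intro!: min.coboundedI1)

lemma seq_dist_commute: "seq_dist a b = seq_dist b a"
  by (simp add: seq_dist_def commute)

lemma seq_dist_triangle:
  assumes "range a \<subseteq> M" "range b \<subseteq> M" "range c \<subseteq> M"
  shows "seq_dist a c \<le> seq_dist a b + seq_dist b c"
proof (rule seq_dist_least)
  fix k
  have "d (a k) (c k) \<le> d (a k) (b k) + d (b k) (c k)"
    using assms by (intro triangle) auto
  then show "min (2 / (real k + 2)) (d (a k) (c k)) \<le> seq_dist a b + seq_dist b c"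
    using seq_dist_upper[of k a b] seq_dist_upper[of k b c] nonneg[of "a k" "b k"] nonneg[of "b k" "c k"]
    by (smt (verit) divide_nonneg_nonneg of_nat_0_le_iff)
qed

lemma seq_dist_eq_0:
  assumes "range a \<subseteq> M" "range b \<subseteq> M"
  shows "seq_dist a b = 0 \<longleftrightarrow> a = b"
proof
  assume 0: "seq_dist a b = 0"
  show "a = b"
  proof
    fix k
    have "2 / (real k + 2) > 0" by simp
    then have "d (a k) (b k) = 0"
      using seq_dist_upper[of k a b] nonneg[of "a k" "b k"] unfolding 0 by linarith
    then show "a k = b k" using assms by (metis range_subsetD zero)
  qed
next
  assume "a = b"
  then have "seq_dist a b \<le> 0"
    using assms by (intro seq_dist_least) (simp add: min.coboundedI2 image_subset_iff)
  then show "seq_dist a b = 0" using seq_dist_nonneg[of a b] by simp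
qed

text \<open>Terms of large index contribute at most their small weight, so closeness in finitely
  many terms suffices; the triangle inequality then passes from \<open>seq_dist (g x) (g y)\<close>
  to the distances from \<open>b\<close>.\<close>

lemma continuous_map_seq_dist:
  assumes g: "\<And>k. continuous_map X mtopology (\<lambda>x. g x k)" and b: "range b \<subseteq> M"
  shows "continuous_map X euclideanreal (\<lambda>x. seq_dist b (g x))"
  unfolding Met_TC.continuous_map_to_metric[simplified mtopology_is_euclidean]
proof (intro ballI allI impI)
  fix x and e :: real assume x: "x \<in> topspace X" and e: "e > 0"
  have gM: "range (g y) \<subseteq> M" if "y \<in> topspace X" for y
    using g that by (auto simp: continuous_map_def)
  obtain n where n: "4 / e < real n" using reals_Archimedean2 by blast
  define V where "V = topspace X \<inter> (\<Inter>k<n. {y \<in> topspace X. g y k \<in> mball (g x k) (e/2)})"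
  have "openin X V"
    unfolding V_def
  proof (rule openin_Int_Inter)
    show "openin X T" if "T \<in> (\<lambda>k. {y \<in> topspace X. g y k \<in> mball (g x k) (e/2)}) ` {..<n}" for T
      using that by clarify (rule openin_continuous_map_preimage[OF g openin_mball])
  qed auto
  moreover have "x \<in> V" using x gM[OF x] e by (auto simp: V_def image_subset_iff)
  moreover have "seq_dist b (g y) \<in> Met_TC.mball (seq_dist b (g x)) e" if y: "y \<in> V" for y
  proof -
    have yX: "y \<in> topspace X" using y by (simp add: V_def)
    have "seq_dist (g x) (g y) \<le> e/2"
    proof (rule seq_dist_least)
      fix k
      show "min (2 / (real k + 2)) (d (g x k) (g y k)) \<le> e/2"
      proof (cases "k < n")
        case True
        then have "d (g x k) (g y k) < e/2" using y by (auto simp: V_def)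
          then show ?thesis by linarith
      next
        case False
        then have "4 / e < real k + 2" using n by simp
        then have "2 / (real k + 2) \<le> e/2" using e by (simp add: field_simps)
        then show ?thesis by simp
      qed
    qed
    then have "\<bar>seq_dist b (g x) - seq_dist b (g y)\<bar> < e"
      using seq_dist_triangle[OF b gM[OF x] gM[OF yX]] seq_dist_triangle[OF b gM[OF yX] gM[OF x]]
        seq_dist_commute[of "g x" "g y"] e by linarith
    then show ?thesis by (simp add: dist_real_def)
  qed
  ultimately show "\<exists>V. openin X V \<and> x \<in> V \<and> (\<forall>y\<in>V. seq_dist b (g y) \<in> Met_TC.mball (seq_dist b (g x)) e)"
    by blast
qed

end

section \<open>Separately continuous extension in a single coordinate\<close>

text \<open>Meant for a section of the extension: \<open>W\<close> is where \<open>\<rho>\<close> is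
  nonzero and the path formula applies, and its complement is a fibre on which the section is
  constant. Continuity there is tested with neighbourhoods of the whole fibre.\<close>

lemma continuous_map_glue_fibre:
  assumes W: "openin X W" and F: "continuous_map (subtopology X W) Y F"
    and z: "z \<in> topspace Y" and Fz: "\<And>x. x \<in> topspace X - W \<Longrightarrow> F x = z"
    and near: "\<And>U. \<lbrakk>openin Y U; z \<in> U\<rbrakk> \<Longrightarrow> \<exists>V. openin X V \<and> topspace X - W \<subseteq> V \<and> F ` V \<subseteq> U"
  shows "continuous_map X Y F"
  unfolding continuous_map_def
proof (intro conjI allI impI)
  have WX: "W \<subseteq> topspace X" using W by (rule openin_subset)
  show "F \<in> topspace X \<rightarrow> topspace Y"
  proof
    fix x assume "x \<in> topspace X"
    then show "F x \<in> topspace Y"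
      using z Fz[of x] F by (cases "x \<in> W") (auto simp: continuous_map_def)
  qed
  fix U assume U: "openin Y U"
  have "openin (subtopology X W) {x \<in> topspace (subtopology X W). F x \<in> U}"
    by (rule openin_continuous_map_preimage[OF F U])
  moreover have "{x \<in> topspace (subtopology X W). F x \<in> U} = {x \<in> W. F x \<in> U}"
    using WX by auto
  ultimately have O: "openin X {x \<in> W. F x \<in> U}"
    using W openin_trans_full by metis
  show "openin X {x \<in> topspace X. F x \<in> U}"
  proof (cases "z \<in> U")
    case True
    then obtain V where V: "openin X V" "topspace X - W \<subseteq> V" "F ` V \<subseteq> U"
      using near U by blast
    have "{x \<in> topspace X. F x \<in> U} = V \<union> {x \<in> W. F x \<in> U}"
      using V WX openin_subset[OF V(1)] by blast
    then show ?thesis using O V by (simp add: openin_Un)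
  next
    case False
    then have "{x \<in> topspace X. F x \<in> U} = {x \<in> W. F x \<in> U}"
      using WX Fz by blast
    then show ?thesis using O by simp
  qed
qed

text \<open>The last conclusion is what later allows the coordinates to be combined in the box
  product. The map built is not symmetric in general: at \<open>(x, y)\<close> the path of
  \<open>x\<close> is followed, at \<open>(y, x)\<close> that of \<open>y\<close>, both up to the
  same time.\<close>

lemma separately_continuous_with_diagonal_limit:
  fixes X :: "'a topology" and Y :: "'b topology" and g :: "'a \<Rightarrow> 'b"
  assumes metr: "metrizable_space Y" and equi: "equiconnected_space Y"
    and gk: "\<And>k :: nat. continuous_map X Y (gk k)"
    and lim: "\<And>x. x \<in> topspace X \<Longrightarrow> limitin Y (\<lambda>k. gk k x) (g x) sequentially"
    and c: "c \<in> topspace Y"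
  obtains f where "separately_continuous_map X Y f"
    and "\<And>x. x \<in> topspace X \<Longrightarrow> f (x, x) = g x"
    and "\<And>x y. \<lbrakk>x \<in> topspace X; y \<in> topspace X; \<And>k. gk k x = c\<rbrakk> \<Longrightarrow> f (x, y) = c \<and> f (y, x) = c"
proof -
  obtain M d where "Metric_space M d" and Y: "Y = Metric_space.mtopology M d"
    using metr by (auto simp: metrizable_space_def)
  then interpret Metric_space M d by simp
  obtain h where h: "continuous_map (prod_topology Y (prod_topology Y (top_of_set {0..1::real}))) Y h"
    and h01: "\<And>x y. \<lbrakk>x \<in> topspace Y; y \<in> topspace Y\<rbrakk> \<Longrightarrow> h (x, y, 0) = x \<and> h (y, x, 1) = x"
    and hid: "\<And>x t. \<lbrakk>x \<in> topspace Y; t \<in> {0..1}\<rbrakk> \<Longrightarrow> h (x, x, t) = x"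
    using equi unfolding equiconnected_space_def by blast
  have frac: "frac t \<in> {0..1}" for t :: real
    using frac_ge_0[of t] frac_lt_1[of t] by simp

  \<comment> \<open>Prepending \<open>c\<close> makes every path start at \<open>c\<close>, so time
    0 gives \<open>c\<close> whichever path is followed.\<close>
  define p where "p = (\<lambda>x k. case k of 0 \<Rightarrow> c | Suc j \<Rightarrow> gk j x)"
  define u where "u = (\<lambda>x. seq_dist (\<lambda>_. c) (p x))"
  define \<rho> where "\<rho> = (\<lambda>x y. seq_dist (p x) (p y))"
  define \<tau> where "\<tau> = (\<lambda>x y. min (u x) (u y) / \<rho> x y)"
  \<comment> \<open>When \<open>\<rho> x y = 0\<close> the two sequences coincide, hence so do their
    limits and \<open>g x = g y\<close>.\<close>
  define f where "f = (\<lambda>(x, y). if \<rho> x y = 0 then g x else telescope h (p x) (\<tau> x y))"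

  have pcont: "continuous_map X Y (\<lambda>x. p x k)" for k
    using gk c by (cases k) (auto simp: p_def)
  have pM: "range (p x) \<subseteq> M" if "x \<in> topspace X" for x
    using pcont that by (auto simp: continuous_map_def Y)
  have cM: "range (\<lambda>_::nat. c) \<subseteq> M"
    using c by (auto simp: Y)
  have plim: "limitin Y (p x) (g x) sequentially" if "x \<in> topspace X" for x
    by (rule limitin_sequentially_offset_rev[of _ _ 1]) (use lim[OF that] in \<open>simp add: p_def\<close>)
  have gY: "g x \<in> topspace Y" if "x \<in> topspace X" for x
    using lim[OF that] by (simp add: limitin_def)
  have u_nonneg: "u x \<ge> 0" for x
    by (simp add: u_def seq_dist_nonneg)
  have \<rho>_nonneg: "\<rho> x y \<ge> 0" for x y
    by (simp add: \<rho>_def seq_dist_nonneg)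
  have \<rho>_commute: "\<rho> x y = \<rho> y x" for x y
    by (simp add: \<rho>_def seq_dist_commute)
  have \<tau>_commute: "\<tau> x y = \<tau> y x" for x y
    by (simp add: \<tau>_def \<rho>_commute[of x y] min.commute)
  have \<tau>_nonneg: "\<tau> x y \<ge> 0" for x y
    by (simp add: \<tau>_def u_nonneg \<rho>_nonneg)
  have ucont: "continuous_map X euclideanreal u"
    unfolding u_def using pcont cM by (intro continuous_map_seq_dist) (auto simp: Y)
  have \<rho>cont: "continuous_map X euclideanreal (\<rho> x)" if "x \<in> topspace X" for x
    unfolding \<rho>_def using pcont pM[OF that] by (intro continuous_map_seq_dist) (auto simp: Y)
  have \<rho>0: "p x = p y" if "x \<in> topspace X" "y \<in> topspace X" "\<rho> x y = 0" for x y
    using that seq_dist_eq_0[OF pM pM] by (simp add: \<rho>_def)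
  have g_eq: "g x = g y" if "x \<in> topspace X" "y \<in> topspace X" "\<rho> x y = 0" for x y
    using plim[OF that(1)] plim[OF that(2)] \<rho>0[OF that] limitin_metric_unique[of "p y"]
    by (simp add: Y)
  have \<rho>_refl: "\<rho> x x = 0" if "x \<in> topspace X" for x
    using seq_dist_eq_0[OF pM pM] that by (simp add: \<rho>_def)

  \<comment> \<open>If \<open>u x = 0\<close>, the path of \<open>x\<close> is constantly
    \<open>c\<close>, while the path of \<open>y\<close> is evaluated at time 0.\<close>
  have const: "f (x, y) = c \<and> f (y, x) = c"
    if x: "x \<in> topspace X" and y: "y \<in> topspace X" and u0: "u x = 0" for x y
  proof -
    have px: "p x = (\<lambda>_. c)"
      using u0 seq_dist_eq_0[OF cM pM[OF x]] by (simp add: u_def)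
    have gx: "g x = c"
      using plim[OF x] c limitin_metric_unique[of "p x" "g x" sequentially c] by (simp add: Y px)
    have "\<tau> x y = 0" using u0 u_nonneg[of y] by (simp add: \<tau>_def)
    then have "telescope h (p y) (\<tau> y x) = c"
      using h01[of "p y 0" "p y 1"] pM[OF y] by (simp add: telescope_def \<tau>_commute[of y x] Y range_subsetD) (simp add: p_def)
    moreover have "telescope h (p x) (\<tau> x y) = c"
      using hid[OF c frac] by (simp add: telescope_def px)
    ultimately show ?thesis
      using gx g_eq[OF y x] by (simp add: f_def)
  qed

  have near: "\<exists>V. openin X V \<and> {y \<in> topspace X. \<rho> x y = 0} \<subseteq> V \<and> (\<forall>y\<in>V. f (x, y) \<in> U \<and> f (y, x) \<in> U)"
    if x: "x \<in> topspace X" and ux: "u x > 0" and U: "openin Y U" "g x \<in> U" for x U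
  proof -
    obtain N where N: "openin Y N" "g x \<in> N" "\<And>a b t. \<lbrakk>a \<in> N; b \<in> N; t \<in> {0..1}\<rbrakk> \<Longrightarrow> h (a, b, t) \<in> U"
      using equiconnecting_tube[OF h hid[OF gY[OF x]] U] by blast
    then obtain e where e: "e > 0" "mball (g x) e \<subseteq> N"
      unfolding Y openin_mtopology by blast
    then obtain K0 where K0: "\<And>k. k \<ge> K0 \<Longrightarrow> d (p x k) (g x) < e/2"
      using plim[OF x] unfolding Y limitin_metric eventually_sequentially by (meson half_gt_zero)
    obtain K1 where K1: "2 / e < real K1" using reals_Archimedean2 by blast
    \<comment> \<open>\<open>K0\<close> brings the terms of \<open>p x\<close> close to
      \<open>g x\<close>, \<open>K1\<close> makes \<open>1 / K\<close> small, and 4 serves the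
      comparison of \<open>1 / n\<close> with the weights of index \<open>n\<close> and
      \<open>Suc n\<close>.\<close>
    define K where "K = max 4 (max K0 K1)"
    have Ke: "1 / real K < e/2"
    proof -
      have "2 / e < real K" using K1 by (simp add: K_def)
      moreover have "real K > 0" by (simp add: K_def)
      ultimately show ?thesis using e(1) by (simp add: field_simps)
    qed
    \<comment> \<open>Off the fibre this says that the time exceeds \<open>K\<close>. Without the
      division it also makes sense on the fibre, where it holds because
      \<open>u y = u x > 0\<close>.\<close>
    define V where "V = {y \<in> topspace X. min (u x) (u y) - real K * \<rho> x y \<in> {0<..}}"
    have "openin X V"
      unfolding V_def
      by (intro openin_continuous_map_preimage[where Y = euclideanreal] continuous_map_diff continuous_map_real_min
          continuous_map_real_mult_left ucont \<rho>cont[OF x]) auto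
    moreover have "y \<in> V" if y: "y \<in> topspace X" "\<rho> x y = 0" for y
      using ux \<rho>0[OF x y] y by (simp add: V_def u_def)
    moreover have "f (x, y) \<in> U \<and> f (y, x) \<in> U" if y: "y \<in> V" for y
    proof (cases "\<rho> x y = 0")
      case True
      then have "g y = g x" using g_eq[OF x, of y] y by (simp add: V_def)
      then show ?thesis using True U by (simp add: f_def \<rho>_commute[of y x])
    next
      case False
      have yX: "y \<in> topspace X" using y by (simp add: V_def)
      have \<rho>: "\<rho> x y > 0" using False \<rho>_nonneg[of x y] by simp
      define n where "n = nat \<lfloor>\<tau> x y\<rfloor>"
      have "real K < \<tau> x y" using y \<rho> by (simp add: V_def \<tau>_def field_simps)
      then have nK: "n \<ge> K" by (simp add: n_def le_nat_floor)
      have n4: "n \<ge> 4" using nK by (simp add: K_def)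
      have "real n \<le> \<tau> x y" using \<tau>_nonneg[of x y] by (simp add: n_def)
      then have "real n * \<rho> x y \<le> min (u x) (u y)"
        using \<rho> by (simp add: \<tau>_def field_simps)
      also have "\<dots> \<le> 1" using seq_dist_le_1 by (simp add: u_def min.coboundedI1)
      finally have \<rho>n: "\<rho> x y \<le> 1 / real n"
        using n4 by (simp add: field_simps)
      have in_N: "p a k \<in> N" if "a = x \<or> a = y" and k: "k = n \<or> k = Suc n" for a k
      proof -
        have kK: "k \<ge> K0" using k nK by (auto simp: K_def)
        \<comment> \<open>For \<open>k = Suc n\<close> this amounts to \<open>n > 3\<close>. As
          \<open>\<rho> x y\<close> lies below the weight of index \<open>k\<close>, the minimum in
          \<open>seq_dist\<close> must be the distance of the terms themselves.\<close>
        have "1 / real n < 2 / (real k + 2)"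
          using k n4 by (auto simp: field_simps)
        then have "d (p x k) (p y k) \<le> 1 / real n"
          using seq_dist_upper[of k "p x" "p y"] \<rho>n unfolding \<rho>_def by linarith
        also have "\<dots> \<le> 1 / real K"
          using nK by (intro divide_left_mono) (auto simp: K_def)
        finally have "d (p x k) (p y k) < e/2" using Ke by simp
        moreover have "d (g x) (p y k) \<le> d (p x k) (g x) + d (p x k) (p y k)"
          using triangle[of "g x" "p x k" "p y k"] commute[of "g x" "p x k"] gY[OF x] pM[OF x] pM[OF yX]
          by (auto simp: Y)
        ultimately have "p a k \<in> mball (g x) e"
          using that(1) K0[OF kK] commute[of "g x" "p x k"] gY[OF x] pM[OF x] pM[OF yX] e(1)
          by (auto simp: Y)
        then show ?thesis using e(2) by blast
      qed
      have "telescope h (p x) (\<tau> x y) \<in> U" "telescope h (p y) (\<tau> y x) \<in> U"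
        unfolding telescope_def \<tau>_commute[of y x] n_def[symmetric]
        by (intro N(3) in_N frac; simp)+
      then show ?thesis using False by (simp add: f_def \<rho>_commute[of y x])
    qed
    ultimately show ?thesis by blast
  qed

  have sep: "continuous_map X Y (\<lambda>y. f (x, y)) \<and> continuous_map X Y (\<lambda>y. f (y, x))"
    if x: "x \<in> topspace X" for x
  proof (cases "u x = 0")
    case True
    have "continuous_map X Y (\<lambda>y. c)" using c by simp
    then show ?thesis
      using const[OF x _ True] by (intro conjI; elim continuous_map_eq) auto
  next
    case False
    then have ux: "u x > 0" using u_nonneg[of x] by simp
    define W where "W = {y \<in> topspace X. \<rho> x y \<in> - {0}}"
    have W: "openin X W"
      unfolding W_def by (rule openin_continuous_map_preimage[OF \<rho>cont[OF x]]) (simp add: open_Compl)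
    have fibre: "topspace X - W = {y \<in> topspace X. \<rho> x y = 0}"
      by (auto simp: W_def)
    have \<tau>cont: "continuous_map (subtopology X W) euclideanreal (\<tau> x)"
      unfolding \<tau>_def
      by (intro continuous_map_real_divide continuous_map_real_min continuous_map_from_subtopology ucont \<rho>cont[OF x])
         (auto simp: W_def)
    \<comment> \<open>Stated for a general \<open>a\<close> to cover both sections: with
      \<open>x\<close> first only the time moves, with \<open>x\<close> second the sequence moves
      too.\<close>
    have tele: "continuous_map (subtopology X W) Y (\<lambda>y. telescope h (a y) (\<tau> x y))"
      if "\<And>k. continuous_map X Y (\<lambda>y. a y k)" for a
      by (intro continuous_map_telescope[OF h h01] continuous_map_from_subtopology[OF that] \<tau>cont \<tau>_nonneg)
    have px: "continuous_map X Y (\<lambda>y. p x k)" for k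
      using pM[OF x] by (auto simp: Y)
    show ?thesis
    proof (intro conjI; rule continuous_map_glue_fibre[OF W _ gY[OF x]])
      show "continuous_map (subtopology X W) Y (\<lambda>y. f (x, y))"
        by (rule continuous_map_eq[OF tele[of "\<lambda>y. p x", OF px]]) (auto simp: f_def W_def)
      show "continuous_map (subtopology X W) Y (\<lambda>y. f (y, x))"
        by (rule continuous_map_eq[OF tele[of p, OF pcont]])
           (auto simp: f_def W_def \<tau>_commute[of _ x] \<rho>_commute[of _ x])
      show "f (x, y) = g x" "f (y, x) = g x" if "y \<in> topspace X - W" for y
        using that g_eq[OF x, of y] by (auto simp: f_def fibre \<rho>_commute[of _ x])
      fix U assume U: "openin Y U" "g x \<in> U"
      show "\<exists>V. openin X V \<and> topspace X - W \<subseteq> V \<and> (\<lambda>y. f (x, y)) ` V \<subseteq> U"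
           "\<exists>V. openin X V \<and> topspace X - W \<subseteq> V \<and> (\<lambda>y. f (y, x)) ` V \<subseteq> U"
        unfolding fibre using near[OF x ux U] by blast+
    qed
  qed
  show ?thesis
  proof (rule that)
    show "separately_continuous_map X Y f"
      using sep by (simp add: separately_continuous_map_def)
    show "f (x, x) = g x" if "x \<in> topspace X" for x
      using \<rho>_refl[OF that] by (simp add: f_def)
    show "f (x, y) = c \<and> f (y, x) = c"
      if "x \<in> topspace X" "y \<in> topspace X" "\<And>k. gk k x = c" for x y
    proof (rule const[OF that(1,2)])
      have "p x = (\<lambda>_. c)" using that(3) by (auto simp: p_def split: nat.split)
      then show "u x = 0" using seq_dist_eq_0[OF cM cM] by (simp add: u_def)
    qed
  qed
qed

section \<open>Assembling the coordinates in the box product\<close>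

theorem theorem1p1:
  fixes X :: "'a topology"
    and S :: "'s set"
    and Z :: "'s \<Rightarrow> 'b topology"
    and g :: "'a \<Rightarrow> 's \<Rightarrow> 'b"
  assumes "paracompact_space X"
    and "connected_space X"
    and "\<And>s. s \<in> S \<Longrightarrow> equiconnected_space (Z s)"
    and "\<And>s. s \<in> S \<Longrightarrow> metrizable_space (Z s)"
    and "Baire_one_map X (box_topology Z S) g"
  shows "\<exists>f :: 'a \<times> 'a \<Rightarrow> 's \<Rightarrow> 'b.
           separately_continuous_map X (box_topology Z S) f \<and>
           (\<forall>x\<in>topspace X. f (x, x) = g x)"
proof (cases "topspace X = {}")
  case True
  then show ?thesis by (simp add: separately_continuous_map_def)
next
  case False
  then obtain x0 where x0: "x0 \<in> topspace X" by blast
  obtain gk :: "nat \<Rightarrow> 'a \<Rightarrow> 's \<Rightarrow> 'b"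
    where gk: "\<And>k. continuous_map X (box_topology Z S) (gk k)"
      and lim: "\<And>x. x \<in> topspace X \<Longrightarrow> limitin (box_topology Z S) (\<lambda>k. gk k x) (g x) sequentially"
    using assms(5) by (auto simp: Baire_one_map_def)
  have gPi: "g x \<in> (\<Pi>\<^sub>E s\<in>S. topspace (Z s))" if "x \<in> topspace X" for x
    using lim[OF that] by (simp add: limitin_def topspace_box_topology)
  have t1: "t1_space (Z s)" if "s \<in> S" for s
    using assms(4)[OF that] metrizable_imp_t1_space by blast
  \<comment> \<open>The first \<open>K\<close> maps are dropped: from \<open>K\<close> on, all
    values at \<open>x0\<close> agree with \<open>g x0\<close> outside one finite set of
    coordinates.\<close>
  obtain K where K: "finite {s \<in> S. \<exists>k\<ge>K. gk k x0 s \<noteq> g x0 s}"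
    using limitin_box_eventually_equal[OF lim[OF x0] t1] by blast
  define E where "E = (\<lambda>x. {s \<in> S. \<exists>k. gk (k + K) x s \<noteq> g x0 s})"
  have E_fin: "finite (E x)" if x: "x \<in> topspace X" for x
  proof -
    \<comment> \<open>For a single \<open>k\<close>, connectedness compares \<open>gk k x\<close>
      with \<open>gk k x0\<close>, and the choice of \<open>K\<close> compares the latter with
      \<open>g x0\<close>.\<close>
    have stage: "finite {s \<in> S. gk k x s \<noteq> g x0 s}" if "k \<ge> K" for k
    proof (rule finite_subset)
      show "{s \<in> S. gk k x s \<noteq> g x0 s} \<subseteq> {s \<in> S. gk k x s \<noteq> gk k x0 s} \<union> {s \<in> S. \<exists>k\<ge>K. gk k x0 s \<noteq> g x0 s}"
        using that by auto
      show "finite ({s \<in> S. gk k x s \<noteq> gk k x0 s} \<union> {s \<in> S. \<exists>k\<ge>K. gk k x0 s \<noteq> g x0 s})"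
        using connected_continuous_box_finite_difference[OF assms(2) gk assms(4) x x0] K by simp
    qed
    obtain L where L: "finite {s \<in> S. \<exists>k\<ge>L. gk k x s \<noteq> g x s}"
      using limitin_box_eventually_equal[OF lim[OF x] t1] by blast
    have "E x \<subseteq> (\<Union>k\<in>{K..K + L}. {s \<in> S. gk k x s \<noteq> g x0 s}) \<union> {s \<in> S. \<exists>k\<ge>L. gk k x s \<noteq> g x s}"
    proof
      fix s assume s: "s \<in> E x"
      show "s \<in> (\<Union>k\<in>{K..K + L}. {s \<in> S. gk k x s \<noteq> g x0 s}) \<union> {s \<in> S. \<exists>k\<ge>L. gk k x s \<noteq> g x s}"
      proof (rule ccontr)
        assume n: "\<not> ?thesis"
        have sS: "s \<in> S" using s by (simp add: E_def)
        have low: "gk k x s = g x0 s" if "K \<le> k" "k \<le> K + L" for k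
          using n that sS by auto
        have high: "gk k x s = g x s" if "k \<ge> L" for k
          using n that sS by auto
        \<comment> \<open>The index \<open>K + L\<close> lies in both ranges, which forces
          \<open>g x s = g x0 s\<close>; the two ranges together contain every index from
          \<open>K\<close> on.\<close>
        have "gk (k + K) x s = g x0 s" for k
          using low[of "k + K"] low[of "K + L"] high[of "k + K"] high[of "K + L"] by (cases "k \<le> L") auto
        then show False using s by (simp add: E_def)
      qed
    qed
    then show ?thesis
      by (rule finite_subset) (use stage L in simp)
  qed
  have "\<exists>F. separately_continuous_map X (Z s) F \<and> (\<forall>x\<in>topspace X. F (x, x) = g x s) \<and>
      (\<forall>x\<in>topspace X. \<forall>y\<in>topspace X. s \<notin> E x \<longrightarrow> F (x, y) = g x0 s \<and> F (y, x) = g x0 s)"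
    if s: "s \<in> S" for s
  proof -
    have cont: "continuous_map X (Z s) (\<lambda>x. gk (k + K) x s)" for k
      by (rule continuous_map_box_coordinate[OF gk s])
    have flim: "limitin (Z s) (\<lambda>k. gk (k + K) x s) (g x s) sequentially" if "x \<in> topspace X" for x
      by (rule limitin_sequentially_offset[OF limitin_box_coordinate[OF lim[OF that] s]])
    have g0: "g x0 s \<in> topspace (Z s)"
      using gPi[OF x0] s by auto
    obtain F where "separately_continuous_map X (Z s) F"
        "\<And>x. x \<in> topspace X \<Longrightarrow> F (x, x) = g x s"
        "\<And>x y. \<lbrakk>x \<in> topspace X; y \<in> topspace X; \<And>k. gk (k + K) x s = g x0 s\<rbrakk> \<Longrightarrow> F (x, y) = g x0 s \<and> F (y, x) = g x0 s"
      by (rule separately_continuous_with_diagonal_limit[OF assms(4)[OF s] assms(3)[OF s] cont flim g0]) blast+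
    then show ?thesis
      using s by (intro exI[of _ F]) (auto simp: E_def)
  qed
  then obtain F where F: "\<And>s. s \<in> S \<Longrightarrow> separately_continuous_map X (Z s) (F s)"
    and Fdiag: "\<And>s x. \<lbrakk>s \<in> S; x \<in> topspace X\<rbrakk> \<Longrightarrow> F s (x, x) = g x s"
    and Fconst: "\<And>s x y. \<lbrakk>s \<in> S; x \<in> topspace X; y \<in> topspace X; s \<notin> E x\<rbrakk>
        \<Longrightarrow> F s (x, y) = g x0 s \<and> F s (y, x) = g x0 s"
    by metis
  \<comment> \<open>The restriction makes the values extensional, as points of the box product must
    be.\<close>
  define f where "f = (\<lambda>q. \<lambda>s\<in>S. F s q)"
  have "separately_continuous_map X (box_topology Z S) f"
    unfolding separately_continuous_map_def
  proof (intro ballI conjI)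
    fix x assume x: "x \<in> topspace X"
    \<comment> \<open>The finite set \<open>E x\<close> of the fixed point serves both sections,
      whatever \<open>E y\<close> is.\<close>
    show "continuous_map X (box_topology Z S) (\<lambda>y. f (x, y))"
      by (rule continuous_map_into_box_finite[OF _ _ E_fin[OF x], where c = "g x0"])
         (use F x Fconst in \<open>auto simp: f_def separately_continuous_map_def\<close>)
    show "continuous_map X (box_topology Z S) (\<lambda>y. f (y, x))"
      by (rule continuous_map_into_box_finite[OF _ _ E_fin[OF x], where c = "g x0"])
         (use F x Fconst in \<open>auto simp: f_def separately_continuous_map_def\<close>)
  qed
  moreover have "f (x, x) = g x" if x: "x \<in> topspace X" for x
    using gPi[OF x] Fdiag x by (auto simp: f_def PiE_iff extensional_def restrict_def)
  ultimately show ?thesis by blast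
qed

end
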